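(* Let $r>3$ and $m\ge 2$ be integers and let $a,b,c,d$ be nonnegative integers, not all zero. Let $F=F(a,b,c,d)$ and $\alpha=\max\{a,d,\min\{b,c\}\}$, and suppose $(r-2)^{m-2}\ge 2\max\{a,b,c,d\}$. If $\alpha>0$, then \[\operatorname{forb}\big(m,r,F(a,b,c,d)\big)=m(r-1)^{m-1}+(r-1)^m+(\alpha-1)\binom{m}{2}.\] Otherwise (that is, $a=d=0$ and $\min\{b,c\}=0$), $F$ is the configuration $p\cdot\left[\begin{smallmatrix}0\\1\end{smallmatrix}\right]$ with $p=\max\{b,c\}$, and \[\operatorname{forb}\big(m,r,p\cdot\left[\begin{smallmatrix}0\\1\end{smallmatrix}\right]\big)=2(r-1)^m-(r-2)^m+(p-1)m(m-1).\]
   Context: For an integer $r\ge2$, an $r$-matrix is a matrix with entries in $\{0,1,\dots,r-1\}$; a $(0,1)$-matrix is a $2$-matrix. A matrix is simple if it has no repeated columns. For matrices $F$ and $A$, $F$ is a configuration of $A$, written $F\prec A$, if $A$ contains a submatrix that is a row and column permutation of $F$; otherwise $A$ avoids $F$. $\operatorname{forb}(m,r,F)$ is the maximum number of columns of a simple $m$-rowed $r$-matrix that avoids $F$. For a matrix $F$ and positive integer $p$, $p\cdot F$ denotes the matrix consisting of $p$ copies of $F$ placed side by side (each column repeated $p$ times). $F(a,b,c,d)$ is the $2$-rowed $(0,1)$-matrix with $a$ columns $\left[\begin{smallmatrix}0\\0\end{smallmatrix}\right]$, $b$ columns $\left[\begin{smallmatrix}1\\0\end{smallmatrix}\right]$,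 $c$ columns $\left[\begin{smallmatrix}0\\1\end{smallmatrix}\right]$ and $d$ columns $\left[\begin{smallmatrix}1\\1\end{smallmatrix}\right]$. *)

theory Defs
  imports
    "Jordan_Normal_Form.DL_Submatrix"
    "HOL-Combinatorics.Permutations"
begin

definition r_matrix :: "nat \<Rightarrow> nat mat \<Rightarrow> bool" where
  "r_matrix r A \<longleftrightarrow> elements_mat A \<subseteq> {0..<r}"

definition simple_mat :: "'a mat \<Rightarrow> bool" where
  "simple_mat A \<longleftrightarrow> distinct (cols A)"

definition row_col_perm :: "'a mat \<Rightarrow> 'a mat \<Rightarrow> bool" where
  "row_col_perm F G \<longleftrightarrow>
     (\<exists>\<sigma> \<tau>. \<sigma> permutes {..<dim_row F} \<and> \<tau> permutes {..<dim_col F} \<and>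
        G = mat (dim_row F) (dim_col F) (\<lambda>(i, j). F $$ (\<sigma> i, \<tau> j)))"

definition configuration :: "'a mat \<Rightarrow> 'a mat \<Rightarrow> bool" where
  "configuration F A \<longleftrightarrow>
     (\<exists>I J. I \<subseteq> {..<dim_row A} \<and> J \<subseteq> {..<dim_col A} \<and> row_col_perm F (submatrix A I J))"

definition avoids :: "'a mat \<Rightarrow> 'a mat \<Rightarrow> bool" where
  "avoids A F \<longleftrightarrow> \<not> configuration F A"

(* Matrices with no columns are allowed, so the set below is nonempty as soon as F has a column;
   it is finite because a simple m-rowed r-matrix has at most r^m columns. *)
definition forb :: "nat \<Rightarrow> nat \<Rightarrow> nat mat \<Rightarrow> nat" where
  "forb m r F =
     Max {dim_col A | A. dim_row A = m \<and> r_matrix r A \<and> simple_mat A \<and> avoids A F}"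

definition copies :: "nat \<Rightarrow> 'a mat \<Rightarrow> 'a mat" where
  "copies p F = mat_of_cols (dim_row F) (concat (replicate p (cols F)))"

(* Inner lists are columns, read from top to bottom. *)
definition F_abcd :: "nat \<Rightarrow> nat \<Rightarrow> nat \<Rightarrow> nat \<Rightarrow> nat mat" where
  "F_abcd a b c d = mat_of_cols_list 2
     (replicate a [0, 0] @ replicate b [1, 0] @ replicate c [0, 1] @ replicate d [1, 1])"

definition col01 :: "nat mat" where
  "col01 = mat_of_cols_list 2 [[0, 1]]"

end

theory Submission
  imports Defs
begin

text \<open>
  View the columns as words over \<open>{0, \<dots>, r - 1}\<close> and group them according to the word obtained by
  replacing every entry \<open>x\<close> by \<open>x - 1\<close> (truncated). A group belongs to a word \<open>u\<close> over
  \<open>{0, \<dots>, r - 2}\<close> and amounts to a family of subsets of the zero set \<open>Z\<close> of \<open>u\<close>.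
  If \<open>F\<close> is avoided, then each pair of rows has a 0-1 pattern that occurs fewer than \<open>\<alpha>\<close> times,
  unless both 01 and 10 occur fewer than \<open>max b c\<close> times. Deleting the columns with these rare
  patterns leaves families that shatter no pair, hence have at most \<open>card Z + 1\<close> members;
  summing over \<open>u\<close> gives \<open>(r - 1)^m + m (r - 1)^(m - 1)\<close>. A pair of the exceptional kind may
  cost up to \<open>2 (max b c - 1)\<close> deletions instead of \<open>\<alpha> - 1\<close>, but the \<open>(r - 2)^(m - 2)\<close> words \<open>u\<close>
  whose zero set is exactly that pair then lose one member each, which pays for it.
  If \<open>\<alpha> = 0\<close>, every pair is exceptional, so the remaining columns are constant on \<open>Z\<close>.
  For equality take all words without the chosen pattern and, for every pair of rows, add as many
  words as allowed that have the pattern there and entries \<open>\<ge> 2\<close> elsewhere.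
\<close>

section \<open>Configurations as embeddings\<close>

lemma bij_betw_pick:
  assumes "finite I"
  shows "bij_betw (pick I) {..<card I} I"
proof -
  have inj: "inj_on (pick I) {..<card I}"
  proof (rule linorder_inj_onI)
    fix i j :: nat
    assume "i < j" "j \<in> {..<card I}"
    then show "pick I i \<noteq> pick I j" using pick_mono_le[of j I i] by auto
  qed auto
  have "pick I ` {..<card I} \<subseteq> I" using pick_in_set_le by auto
  then have "pick I ` {..<card I} = I"
    using assms inj by (simp add: card_image card_subset_eq)
  then show ?thesis using inj by (simp add: bij_betw_def)
qed

text \<open>\<open>submatrix\<close> lists the chosen indices in increasing order;
  \<open>\<sigma>\<close> records how this order differs from the one given by
  \<open>f\<close>.\<close>

lemma pick_image_permutation:
  assumes "inj_on f {..<n}"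
  obtains \<sigma> where "\<sigma> permutes {..<n}" "\<And>i. i < n \<Longrightarrow> pick (f ` {..<n}) i = f (\<sigma> i)"
proof -
  let ?I = "f ` {..<n}"
  let ?h = "inv_into {..<n} f \<circ> pick ?I"
  have pick: "bij_betw (pick ?I) {..<n} ?I"
    using bij_betw_pick[of ?I] assms by (simp add: card_image)
  have "bij_betw (inv_into {..<n} f) ?I {..<n}"
    using assms by (simp add: bij_betw_inv_into inj_on_imp_bij_betw)
  with pick have h: "bij_betw ?h {..<n} {..<n}" by (rule bij_betw_trans)
  define \<sigma> where "\<sigma> i = (if i < n then ?h i else i)" for i
  have "bij_betw \<sigma> {..<n} {..<n}"
    using h by (subst bij_betw_cong[of _ _ ?h]) (auto simp: \<sigma>_def)
  then have "\<sigma> permutes {..<n}"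
    by (rule bij_imp_permutes) (auto simp: \<sigma>_def)
  moreover have "pick ?I i = f (\<sigma> i)" if "i < n" for i
    using bij_betwE[OF pick] that by (auto simp: \<sigma>_def f_inv_into_f)
  ultimately show ?thesis by (rule that)
qed

text \<open>Choosing index sets and then permuting amounts to choosing injections:
  \<open>pick\<close> enumerates a set increasingly, and the permutation accounts for every other
  order.\<close>

lemma configuration_iff_embedding:
  "configuration F A \<longleftrightarrow>
     (\<exists>f g. inj_on f {..<dim_row F} \<and> f ` {..<dim_row F} \<subseteq> {..<dim_row A} \<and>
            inj_on g {..<dim_col F} \<and> g ` {..<dim_col F} \<subseteq> {..<dim_col A} \<and>
            (\<forall>i<dim_row F. \<forall>j<dim_col F. F $$ (i, j) = A $$ (f i, g j)))"
    (is "_ \<longleftrightarrow> ?R")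
proof
  assume "configuration F A"
  then obtain I J \<sigma> \<tau> where I: "I \<subseteq> {..<dim_row A}" and J: "J \<subseteq> {..<dim_col A}"
    and \<sigma>: "\<sigma> permutes {..<dim_row F}" and \<tau>: "\<tau> permutes {..<dim_col F}"
    and sub: "submatrix A I J = mat (dim_row F) (dim_col F) (\<lambda>(i, j). F $$ (\<sigma> i, \<tau> j))"
    unfolding configuration_def row_col_perm_def by blast
  have fin: "finite I" "finite J" using I J finite_subset by blast+
  have sets: "{i. i < dim_row A \<and> i \<in> I} = I" "{j. j < dim_col A \<and> j \<in> J} = J"
    using I J by auto
  have card: "card I = dim_row F" "card J = dim_col F"
    using arg_cong[OF sub, of dim_row] arg_cong[OF sub, of dim_col]
    by (simp_all add: dim_submatrix sets)
  \<comment> \<open>The inverses appear because \<open>row_col_perm\<close> permutes the indices of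
    \<open>F\<close>, not those of the submatrix.\<close>
  let ?f = "pick I \<circ> inv_into UNIV \<sigma>" and ?g = "pick J \<circ> inv_into UNIV \<tau>"
  have f: "bij_betw ?f {..<dim_row F} I"
    using bij_betw_trans[OF permutes_imp_bij[OF permutes_inv[OF \<sigma>]] bij_betw_pick[OF fin(1), unfolded card]] .
  have g: "bij_betw ?g {..<dim_col F} J"
    using bij_betw_trans[OF permutes_imp_bij[OF permutes_inv[OF \<tau>]] bij_betw_pick[OF fin(2), unfolded card]] .
  have "F $$ (i, j) = A $$ (?f i, ?g j)" if "i < dim_row F" "j < dim_col F" for i j
  proof -
    have lt: "inv_into UNIV \<sigma> i < dim_row F" "inv_into UNIV \<tau> j < dim_col F"
      using that permutes_in_image[OF permutes_inv[OF \<sigma>]] permutes_in_image[OF permutes_inv[OF \<tau>]]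
      by auto
    have "A $$ (?f i, ?g j) = submatrix A I J $$ (inv_into UNIV \<sigma> i, inv_into UNIV \<tau> j)"
      using lt by (simp add: submatrix_index sets card)
    also have "\<dots> = F $$ (i, j)"
      using lt by (simp add: sub permutes_inverses[OF \<sigma>] permutes_inverses[OF \<tau>])
    finally show ?thesis ..
  qed
  then show ?R using f g I J unfolding bij_betw_def by (intro exI[of _ ?f] exI[of _ ?g]) auto
next
  assume ?R
  then obtain f g where f: "inj_on f {..<dim_row F}" "f ` {..<dim_row F} \<subseteq> {..<dim_row A}"
    and g: "inj_on g {..<dim_col F}" "g ` {..<dim_col F} \<subseteq> {..<dim_col A}"
    and eq: "\<forall>i<dim_row F. \<forall>j<dim_col F. F $$ (i, j) = A $$ (f i, g j)"
    by (elim exE conjE) (rule that)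
  let ?I = "f ` {..<dim_row F}" and ?J = "g ` {..<dim_col F}"
  obtain \<sigma> where \<sigma>: "\<sigma> permutes {..<dim_row F}" "\<And>i. i < dim_row F \<Longrightarrow> pick ?I i = f (\<sigma> i)"
    by (rule pick_image_permutation[OF f(1)]) (rule that)
  obtain \<tau> where \<tau>: "\<tau> permutes {..<dim_col F}" "\<And>j. j < dim_col F \<Longrightarrow> pick ?J j = g (\<tau> j)"
    by (rule pick_image_permutation[OF g(1)]) (rule that)
  have sets: "{i. i < dim_row A \<and> i \<in> ?I} = ?I" "{j. j < dim_col A \<and> j \<in> ?J} = ?J"
    using f(2) g(2) by auto
  have card: "card ?I = dim_row F" "card ?J = dim_col F"
    using f(1) g(1) by (simp_all add: card_image)
  have "submatrix A ?I ?J = mat (dim_row F) (dim_col F) (\<lambda>(i, j). F $$ (\<sigma> i, \<tau> j))"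
  proof (rule eq_matI)
    fix i j
    assume "i < dim_row (mat (dim_row F) (dim_col F) (\<lambda>(i, j). F $$ (\<sigma> i, \<tau> j)))"
      and "j < dim_col (mat (dim_row F) (dim_col F) (\<lambda>(i, j). F $$ (\<sigma> i, \<tau> j)))"
    then have lt: "i < dim_row F" "j < dim_col F" by simp_all
    then have "\<sigma> i < dim_row F" "\<tau> j < dim_col F"
      using permutes_in_image[OF \<sigma>(1)] permutes_in_image[OF \<tau>(1)] by auto
    then show "submatrix A ?I ?J $$ (i, j)
      = mat (dim_row F) (dim_col F) (\<lambda>(i, j). F $$ (\<sigma> i, \<tau> j)) $$ (i, j)"
      using lt by (simp add: submatrix_index sets card \<sigma>(2) \<tau>(2) eq[rule_format])
  qed (simp_all only: dim_submatrix sets card dim_row_mat dim_col_mat)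
  then show "configuration F A"
    unfolding configuration_def row_col_perm_def using f(2) g(2) \<sigma>(1) \<tau>(1) by blast
qed

text \<open>A label-preserving injection splits into independent injections between the classes of
  equal label, and these exist exactly when the cardinalities allow it. The labels will be the pairs
  of entries that a column has in two rows.\<close>

lemma ex_matching_inj_iff:
  assumes "finite X" and "finite Y"
  shows "(\<exists>g. inj_on g X \<and> g ` X \<subseteq> Y \<and> (\<forall>x\<in>X. p x = q (g x))) \<longleftrightarrow>
         (\<forall>z. card {x \<in> X. p x = z} \<le> card {y \<in> Y. q y = z})" (is "?L \<longleftrightarrow> ?R")
proof
  assume ?L
  then obtain g where g: "inj_on g X" "g ` X \<subseteq> Y" "\<And>x. x \<in> X \<Longrightarrow> p x = q (g x)" by blast
  show ?R
  proof
    fix z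
    show "card {x \<in> X. p x = z} \<le> card {y \<in> Y. q y = z}"
      using g assms by (intro card_inj_on_le[of g]) (auto intro: inj_on_subset)
  qed
next
  assume R: ?R
  have "\<forall>z. \<exists>h. h ` {x \<in> X. p x = z} \<subseteq> {y \<in> Y. q y = z} \<and> inj_on h {x \<in> X. p x = z}"
    using R assms by (intro allI card_le_inj) auto
  from choice[OF this] obtain h
    where h: "\<forall>z. h z ` {x \<in> X. p x = z} \<subseteq> {y \<in> Y. q y = z} \<and> inj_on (h z) {x \<in> X. p x = z}" ..
  define g where "g x = h (p x) x" for x
  have q: "g x \<in> Y \<and> q (g x) = p x" if "x \<in> X" for x
    using h[rule_format, of "p x"] that by (auto simp: g_def)
  have "inj_on g X"
  proof (rule inj_onI)
    fix x x' assume x: "x \<in> X" "x' \<in> X" and eq: "g x = g x'"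
    then have "p x = p x'" using q by metis
    then show "x = x'" using eq x inj_onD[OF conjunct2[OF h[rule_format, of "p x"]]] by (auto simp: g_def)
  qed
  then show ?L using q by (intro exI[of _ g]) auto
qed

section \<open>Pattern counts in two rows\<close>

definition pair_count :: "'a vec set \<Rightarrow> nat \<Rightarrow> nat \<Rightarrow> 'a \<Rightarrow> 'a \<Rightarrow> nat" where
  "pair_count S i j x y = card {v \<in> S. v $ i = x \<and> v $ j = y}"

lemma pair_count_swap: "pair_count S i j x y = pair_count S j i y x"
  unfolding pair_count_def by (rule arg_cong[of _ _ card]) auto

text \<open>In a simple matrix distinct column indices give distinct vectors, so the set of columns
  keeps all multiplicities.\<close>

lemma pair_count_cols:
  assumes "simple_mat A" and "i < dim_row A" and "j < dim_row A"
  shows "card {k \<in> {..<dim_col A}. (A $$ (i, k), A $$ (j, k)) = z}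
         = pair_count (set (cols A)) i j (fst z) (snd z)"
proof -
  let ?K = "{k \<in> {..<dim_col A}. (A $$ (i, k), A $$ (j, k)) = z}"
  have inj: "inj_on (col A) {..<dim_col A}"
  proof (rule inj_onI)
    fix k l assume "k \<in> {..<dim_col A}" "l \<in> {..<dim_col A}" "col A k = col A l"
    then show "k = l"
      using assms(1) unfolding simple_mat_def
      by (metis cols_length cols_nth lessThan_iff nth_eq_iff_index_eq)
  qed
  have "col A ` ?K = {v \<in> set (cols A). v $ i = fst z \<and> v $ j = snd z}"
    using assms(2,3) by (auto simp: cols_def)
  moreover have "inj_on (col A) ?K" by (rule inj_on_subset[OF inj]) auto
  then have "card (col A ` ?K) = card ?K" by (rule card_image)
  ultimately show ?thesis unfolding pair_count_def by simp
qed

text \<open>An embedding of a 2-rowed matrix is an ordered pair of rows together with a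
  pattern-preserving injection of columns, so only the multiplicities of the patterns matter.
  Exchanging \<open>i\<close> and \<open>j\<close> exchanges the roles of \<open>b\<close> and
  \<open>c\<close>.\<close>

lemma configuration_F_abcd_iff:
  assumes "simple_mat A"
  shows "configuration (F_abcd a b c d) A \<longleftrightarrow>
    (\<exists>i<dim_row A. \<exists>j<dim_row A. i \<noteq> j \<and>
       a \<le> pair_count (set (cols A)) i j 0 0 \<and> b \<le> pair_count (set (cols A)) i j 1 0 \<and>
       c \<le> pair_count (set (cols A)) i j 0 1 \<and> d \<le> pair_count (set (cols A)) i j 1 1)"
proof -
  let ?xs = "replicate a [0, 0] @ replicate b [1, 0] @ replicate c [0, 1] @ replicate d [1, 1::nat]"
  let ?F = "F_abcd a b c d" and ?n = "a + b + c + d"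
  have dims: "dim_row ?F = 2" "dim_col ?F = ?n"
    by (simp_all add: F_abcd_def mat_of_cols_list_def)
  have all_lt_2: "(\<forall>i<2. P i) \<longleftrightarrow> P 0 \<and> P 1" for P :: "nat \<Rightarrow> bool"
    by (auto simp: less_2_cases_iff)
  have filter_count: "card {k \<in> {..<?n}. (?F $$ (0, k), ?F $$ (1, k)) = z} =
      length (filter (\<lambda>u. (u ! 0, u ! 1) = z) ?xs)" for z
    unfolding length_filter_conv_card
    by (rule arg_cong[of _ _ card]) (auto simp: F_abcd_def mat_of_cols_list_def)
  have count: "card {k \<in> {..<?n}. (?F $$ (0, k), ?F $$ (1, k)) = z} =
      (if z = (0, 0) then a else if z = (1, 0) then b else if z = (0, 1) then c
       else if z = (1, 1) then d else 0)" for z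
    unfolding filter_count filter_append length_append filter_replicate by (cases z) auto
  have "configuration ?F A \<longleftrightarrow>
     (\<exists>i<dim_row A. \<exists>j<dim_row A. i \<noteq> j \<and>
        (\<exists>g. inj_on g {..<?n} \<and> g ` {..<?n} \<subseteq> {..<dim_col A} \<and>
           (\<forall>k\<in>{..<?n}. (?F $$ (0, k), ?F $$ (1, k)) = (A $$ (i, g k), A $$ (j, g k)))))"
    (is "?L \<longleftrightarrow> ?R")
  proof
    assume ?L
    then obtain f g where f: "inj_on f {..<2}" "f ` {..<2} \<subseteq> {..<dim_row A}"
      and g: "inj_on g {..<?n}" "g ` {..<?n} \<subseteq> {..<dim_col A}"
      and eq: "\<forall>i<2. \<forall>j<?n. ?F $$ (i, j) = A $$ (f i, g j)"
      unfolding configuration_iff_embedding dims by blast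
    have "f 0 \<noteq> f 1" using inj_onD[OF f(1), of 0 1] by auto
    moreover have "f 0 < dim_row A" "f 1 < dim_row A" using f(2) by (simp_all add: image_subset_iff)
    ultimately show ?R using g eq unfolding all_lt_2 by blast
  next
    assume ?R
    then obtain i j g where ij: "i < dim_row A" "j < dim_row A" "i \<noteq> j"
      and g: "inj_on g {..<?n}" "g ` {..<?n} \<subseteq> {..<dim_col A}"
      and eq: "\<forall>k\<in>{..<?n}. (?F $$ (0, k), ?F $$ (1, k)) = (A $$ (i, g k), A $$ (j, g k))"
      by blast
    let ?f = "\<lambda>k::nat. if k = 0 then i else j"
    have "inj_on ?f {..<2}" "?f ` {..<2} \<subseteq> {..<dim_row A}"
      using ij by (auto simp: inj_on_def less_2_cases_iff)
    moreover have "\<forall>l<2. \<forall>k<?n. ?F $$ (l, k) = A $$ (?f l, g k)"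
      using eq unfolding all_lt_2 by auto
    ultimately show ?L unfolding configuration_iff_embedding dims using g by blast
  qed
  also have "\<dots> \<longleftrightarrow> (\<exists>i<dim_row A. \<exists>j<dim_row A. i \<noteq> j \<and>
      (\<forall>z. card {k \<in> {..<?n}. (?F $$ (0, k), ?F $$ (1, k)) = z}
           \<le> card {k \<in> {..<dim_col A}. (A $$ (i, k), A $$ (j, k)) = z}))"
    by (subst ex_matching_inj_iff) simp_all
  \<comment> \<open>Patterns other than the four 0-1 patterns have multiplicity 0 in
    \<open>F_abcd\<close> and impose no condition.\<close>
  also have "\<dots> \<longleftrightarrow> (\<exists>i<dim_row A. \<exists>j<dim_row A. i \<noteq> j \<and>
      (\<forall>z. (if z = (0, 0) then a else if z = (1, 0) then b else if z = (0, 1) then c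
            else if z = (1, 1) then d else 0) \<le> pair_count (set (cols A)) i j (fst z) (snd z)))"
    by (intro ex_cong1 conj_cong refl) (simp only: count[symmetric] pair_count_cols[OF assms])
  also have "\<dots> \<longleftrightarrow> (\<exists>i<dim_row A. \<exists>j<dim_row A. i \<noteq> j \<and>
       a \<le> pair_count (set (cols A)) i j 0 0 \<and> b \<le> pair_count (set (cols A)) i j 1 0 \<and>
       c \<le> pair_count (set (cols A)) i j 0 1 \<and> d \<le> pair_count (set (cols A)) i j 1 1)"
    by (intro ex_cong1 conj_cong refl) auto
  finally show ?thesis .
qed

section \<open>Words, and the reduction of \<open>forb\<close> to families of words\<close>

definition words :: "nat \<Rightarrow> nat \<Rightarrow> nat vec set" where
  "words m q = {v \<in> carrier_vec m. \<forall>i<m. v $ i < q}"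

text \<open>\<open>vec m\<close> is a bijection from the dependent functions on
  \<open>{..<m}\<close>, whose number is the product.\<close>

lemma card_vec_restricted:
  assumes "\<And>i. i < m \<Longrightarrow> finite (B i)"
  shows "finite {v \<in> carrier_vec m. \<forall>i<m. v $ i \<in> B i}"
    and "card {v \<in> carrier_vec m. \<forall>i<m. v $ i \<in> B i} = (\<Prod>i<m. card (B i))"
proof -
  have "vec m ` (\<Pi>\<^sub>E i\<in>{..<m}. B i) = {v \<in> carrier_vec m. \<forall>i<m. v $ i \<in> B i}"
  proof (intro equalityI subsetI)
    fix v assume v: "v \<in> {v \<in> carrier_vec m. \<forall>i<m. v $ i \<in> B i}"
    show "v \<in> vec m ` (\<Pi>\<^sub>E i\<in>{..<m}. B i)"
    proof (rule image_eqI)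
      show "v = vec m (\<lambda>i\<in>{..<m}. v $ i)" using v by (intro eq_vecI) auto
      show "(\<lambda>i\<in>{..<m}. v $ i) \<in> (\<Pi>\<^sub>E i\<in>{..<m}. B i)" using v by auto
    qed
  next
    fix v assume "v \<in> vec m ` (\<Pi>\<^sub>E i\<in>{..<m}. B i)"
    then obtain f where "f \<in> (\<Pi>\<^sub>E i\<in>{..<m}. B i)" "v = vec m f" by blast
    then show "v \<in> {v \<in> carrier_vec m. \<forall>i<m. v $ i \<in> B i}" by (simp add: PiE_mem)
  qed
  moreover have "inj_on (vec m) (\<Pi>\<^sub>E i\<in>{..<m}. B i)"
  proof (rule inj_onI)
    fix f g assume fg: "f \<in> (\<Pi>\<^sub>E i\<in>{..<m}. B i)" "g \<in> (\<Pi>\<^sub>E i\<in>{..<m}. B i)" "vec m f = vec m g"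
    have "f i = g i" if "i < m" for i
      using arg_cong[OF fg(3), of "\<lambda>v. v $ i"] that by simp
    then show "f = g" by (intro PiE_ext[OF fg(1,2)]) simp
  qed
  ultimately have bij: "bij_betw (vec m) (\<Pi>\<^sub>E i\<in>{..<m}. B i) {v \<in> carrier_vec m. \<forall>i<m. v $ i \<in> B i}"
    by (simp add: bij_betw_def)
  show "finite {v \<in> carrier_vec m. \<forall>i<m. v $ i \<in> B i}"
    using bij_betw_finite[OF bij] finite_PiE[of "{..<m}" B] assms by simp
  show "card {v \<in> carrier_vec m. \<forall>i<m. v $ i \<in> B i} = (\<Prod>i<m. card (B i))"
    using bij_betw_same_card[OF bij] by (simp add: card_PiE)
qed

lemma finite_words: "finite (words m q)"
  using card_vec_restricted(1)[of m "\<lambda>_. {..<q}"] by (simp add: words_def)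

lemma card_words: "card (words m q) = q ^ m"
  using card_vec_restricted(2)[of m "\<lambda>_. {..<q}"] by (simp add: words_def)

text \<open>The column sets of simple \<open>m\<close>-rowed \<open>r\<close>-matrices are families
  of words, and every such family can be listed as the columns of one. Applied to the witness, the
  upper bound turns \<open>card S\<^sub>0 \<ge> N\<close> into equality; it also makes the set under
  \<open>Max\<close> finite.\<close>

lemma forb_F_abcd_eqI:
  assumes upper: "\<And>S. S \<subseteq> words m r \<Longrightarrow>
      (\<And>i j. i < m \<Longrightarrow> j < m \<Longrightarrow> i \<noteq> j \<Longrightarrow>
         pair_count S i j 0 0 < a \<or> pair_count S i j 1 0 < b \<or>
         pair_count S i j 0 1 < c \<or> pair_count S i j 1 1 < d) \<Longrightarrow> card S \<le> N"
    and lower: "S\<^sub>0 \<subseteq> words m r" "card S\<^sub>0 \<ge> N"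
      "\<And>i j. i < m \<Longrightarrow> j < m \<Longrightarrow> i \<noteq> j \<Longrightarrow>
         pair_count S\<^sub>0 i j 0 0 < a \<or> pair_count S\<^sub>0 i j 1 0 < b \<or>
         pair_count S\<^sub>0 i j 0 1 < c \<or> pair_count S\<^sub>0 i j 1 1 < d"
  shows "forb m r (F_abcd a b c d) = N"
proof -
  let ?D = "{dim_col A | A. dim_row A = m \<and> r_matrix r A \<and> simple_mat A \<and> avoids A (F_abcd a b c d)}"
  have le: "n \<le> N" if "n \<in> ?D" for n
  proof -
    from that obtain A where A: "n = dim_col A" "dim_row A = m" "r_matrix r A" "simple_mat A"
      "\<not> configuration (F_abcd a b c d) A"
      unfolding mem_Collect_eq avoids_def by (elim exE conjE) (rule that)
    have "set (cols A) \<subseteq> words m r"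
    proof
      fix v assume "v \<in> set (cols A)"
      then obtain k where k: "k < dim_col A" "v = col A k" by (auto simp: cols_def)
      have "A $$ (i, k) < r" if "i < m" for i
      proof -
        have "A $$ (i, k) \<in> elements_mat A"
          using A(2) that k(1) by (intro elements_matI[of A m "dim_col A" i k]) auto
        then show ?thesis using A(3) unfolding r_matrix_def by auto
      qed
      then show "v \<in> words m r" using A(2) k by (auto simp: words_def)
    qed
    moreover have "card (set (cols A)) = n"
      using A(1,4) by (simp add: simple_mat_def distinct_card)
    ultimately show ?thesis
      using upper[of "set (cols A)"] A(5)[unfolded configuration_F_abcd_iff[OF A(4)]] A(2)
      by (metis not_less)
  qed
  have "finite S\<^sub>0" using lower(1) finite_words finite_subset by blast
  then obtain vs where vs: "set vs = S\<^sub>0" "distinct vs" using finite_distinct_list by blast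
  let ?A = "mat_of_cols m vs"
  have cols: "cols ?A = vs"
    using vs(1) lower(1) by (intro cols_mat_of_cols) (auto simp: words_def)
  have simple: "simple_mat ?A" by (simp add: simple_mat_def cols vs)
  have "r_matrix r ?A"
    unfolding r_matrix_def
  proof
    fix x assume "x \<in> elements_mat ?A"
    then obtain i k where "i < m" "k < length vs" "x = vs ! k $ i"
      by (auto dest!: elements_matD simp: mat_of_cols_index)
    then show "x \<in> {0..<r}" using vs(1) lower(1) nth_mem unfolding words_def by fastforce
  qed
  moreover have "avoids ?A (F_abcd a b c d)"
    unfolding avoids_def configuration_F_abcd_iff[OF simple] cols vs(1)
    using lower(3) by (auto simp: not_le[symmetric])
  ultimately have mem: "length vs \<in> ?D" using simple by force
  have "length vs = N"
    using le[OF mem] lower(2) distinct_card[OF vs(2)] vs(1) by simp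
  moreover have "finite ?D" using le by (meson finite_nat_set_iff_bounded_le)
  ultimately show ?thesis
    unfolding forb_def using mem le by (intro Max_eqI) auto
qed

section \<open>The degenerate case: copies of a single mixed column\<close>

lemma mat_of_cols_list_eq_mat_of_cols:
  "mat_of_cols_list n cs = mat_of_cols n (map (\<lambda>c. vec n ((!) c)) cs)"
  by (rule eq_matI) (auto simp: mat_of_cols_list_def mat_of_cols_index)

lemma copies_col01: "copies p col01 = F_abcd 0 0 p 0"
proof -
  have dim: "dim_row col01 = 2" by (simp add: col01_def mat_of_cols_list_def)
  have "cols col01 = [vec 2 ((!) [0, 1])]"
    by (simp add: col01_def mat_of_cols_list_eq_mat_of_cols del: One_nat_def)
  moreover have "concat (replicate p [x]) = replicate p x" for x :: "nat vec"
    by (induction p) auto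
  ultimately show ?thesis
    by (simp add: copies_def dim F_abcd_def mat_of_cols_list_eq_mat_of_cols)
qed

text \<open>All columns are equal here; if they are 10, exchanging the two rows makes them
  01.\<close>

lemma row_col_perm_F_abcd_copies:
  assumes "min b c = 0"
  shows "row_col_perm (F_abcd 0 b c 0) (copies (max b c) col01)"
proof -
  have dims: "dim_row (F_abcd 0 b c 0) = 2" "dim_col (F_abcd 0 b c 0) = b + c"
    by (simp_all add: F_abcd_def mat_of_cols_list_def)
  show ?thesis
  proof (cases "b = 0")
    case True
    then show ?thesis
      unfolding row_col_perm_def copies_col01
      by (intro exI[of _ id] conjI permutes_id eq_matI) (auto simp: F_abcd_def mat_of_cols_list_def)
  next
    case False
    then have "c = 0" using assms by (auto simp: min_def split: if_splits)
    have "Transposition.transpose 0 1 permutes {..<2::nat}"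
      by (rule permutes_swap_id) auto
    then show ?thesis
      unfolding row_col_perm_def copies_col01 dims using \<open>c = 0\<close>
      by (intro exI[of _ "Transposition.transpose 0 1"] exI[of _ id] conjI permutes_id eq_matI)
        (auto simp: F_abcd_def mat_of_cols_list_def less_2_cases_iff)
  qed
qed

section \<open>Families of sets shattering no pair\<close>

text \<open>This is the Sauer-Shelah bound for VC dimension at most 1. When a point \<open>z\<close>
  is dropped, members merge only in pairs \<open>A\<close>, \<open>insert z A\<close>, and there is
  at most one such pair.\<close>

lemma card_le_Suc_if_no_shattered_pair:
  assumes "finite Z" and "F \<subseteq> Pow Z"
    and "\<And>i j. i \<in> Z \<Longrightarrow> j \<in> Z \<Longrightarrow> i \<noteq> j \<Longrightarrow>
           \<exists>s t. \<forall>A\<in>F. \<not> ((i \<in> A) = s \<and> (j \<in> A) = t)"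
  shows "card F \<le> Suc (card Z)"
  using assms
proof (induction Z arbitrary: F rule: finite_induct)
  case empty
  then show ?case using card_mono[of "{{}}" F] by simp
next
  case (insert z Z)
  have finF: "finite F"
    using insert.prems(1) insert.hyps(1) by (meson finite_Pow_iff finite_insert finite_subset)
  let ?D = "{A \<in> F. z \<notin> A \<and> insert z A \<in> F}"
  \<comment> \<open>Two members of \<open>?D\<close> that differ at \<open>i\<close> would, together
    with \<open>insert z A\<close> and \<open>insert z B\<close>, realize all four traces on
    \<open>i\<close> and \<open>z\<close>.\<close>
  have "A = B" if A: "A \<in> ?D" and B: "B \<in> ?D" for A B
  proof (rule ccontr)
    assume "A \<noteq> B"
    then obtain i where i: "(i \<in> A) \<noteq> (i \<in> B)" by auto
    then have "i \<in> Z" "i \<noteq> z" using A B insert.prems(1) by auto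
    then obtain s t where st: "\<forall>C\<in>F. \<not> ((i \<in> C) = s \<and> (z \<in> C) = t)"
      using insert.prems(2)[of i z] by blast
    have "A \<in> F" "B \<in> F" "insert z A \<in> F" "insert z B \<in> F" "z \<notin> A" "z \<notin> B"
      using A B by auto
    then show False using st i \<open>i \<noteq> z\<close> by (metis insert_iff)
  qed
  then have "card ?D \<le> Suc 0"
    using finF by (subst card_le_Suc0_iff_eq) auto
  moreover have "card (F - ?D) \<le> Suc (card Z)"
  proof -
    \<comment> \<open>\<open>?D\<close> holds the smaller member of each merging pair, so without it
      the traces on \<open>Z\<close> are distinct.\<close>
    have "inj_on (\<lambda>A. A - {z}) (F - ?D)"
    proof (rule inj_onI)
      fix A B assume A: "A \<in> F - ?D" and B: "B \<in> F - ?D" and eq: "A - {z} = B - {z}"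
      have "z \<in> A \<longleftrightarrow> z \<in> B"
        using A B eq insert_Diff_single[of z A] insert_Diff_single[of z B]
        by (metis (no_types, lifting) Diff_iff Diff_insert_absorb insert_absorb mem_Collect_eq)
      with eq show "A = B" by blast
    qed
    then have "card (F - ?D) = card ((\<lambda>A. A - {z}) ` (F - ?D))" by (simp add: card_image)
    also have "\<dots> \<le> Suc (card Z)"
    proof (rule insert.IH)
      show "(\<lambda>A. A - {z}) ` (F - ?D) \<subseteq> Pow Z" using insert.prems(1) by auto
    next
      fix i j assume ij: "i \<in> Z" "j \<in> Z" "i \<noteq> j"
      then obtain s t where st: "\<forall>A\<in>F. \<not> ((i \<in> A) = s \<and> (j \<in> A) = t)"
        using insert.prems(2)[of i j] by auto
      have z: "i \<noteq> z" "j \<noteq> z" using ij insert.hyps by auto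
      show "\<exists>s t. \<forall>A\<in>(\<lambda>A. A - {z}) ` (F - ?D). \<not> ((i \<in> A) = s \<and> (j \<in> A) = t)"
      proof (intro exI ballI)
        fix A assume "A \<in> (\<lambda>A. A - {z}) ` (F - ?D)"
        then obtain B where "B \<in> F" "A = B - {z}" by blast
        then show "\<not> ((i \<in> A) = s \<and> (j \<in> A) = t)" using st z by simp
      qed
    qed
    finally show ?thesis .
  qed
  moreover have "card F \<le> card ?D + card (F - ?D)"
    using card_Un_le[of ?D "F - ?D"] by (simp add: Un_absorb1)
  ultimately show ?case using insert.hyps by simp
qed

section \<open>Decomposition of families of words into fibers\<close>

abbreviation lowered :: "nat vec \<Rightarrow> nat vec" where
  "lowered \<equiv> map_vec (\<lambda>x. x - 1)"

definition zeros :: "nat vec \<Rightarrow> nat set" where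
  "zeros u = {i. i < dim_vec u \<and> u $ i = 0}"

lemma finite_zeros [simp]: "finite (zeros u)"
  by (simp add: zeros_def)

section \<open>Counting words by their zeros\<close>

text \<open>Serves three counts: \<open>B = {1..<q}\<close> for words with a given zero set,
  \<open>B = {..<q}\<close> for words with a zero at a given place, and \<open>B = {2..<r}\<close>
  for the extra words of the extremal families.\<close>

lemma card_vec_prescribed:
  assumes "Z \<subseteq> {..<m}" and "finite B"
  shows "card {v \<in> carrier_vec m. \<forall>i<m. v $ i \<in> (if i \<in> Z then {f i} else B)}
         = card B ^ (m - card Z)"
proof -
  have "card {v \<in> carrier_vec m. \<forall>i<m. v $ i \<in> (if i \<in> Z then {f i} else B)}
      = (\<Prod>i<m. card (if i \<in> Z then {f i} else B))"
    using assms(2) by (intro card_vec_restricted(2)) auto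
  also have "\<dots> = (\<Prod>i<m. if i \<in> Z then 1 else card B)"
    by (intro prod.cong) auto
  also have "\<dots> = card B ^ card ({..<m} - Z)"
    by (subst prod.If_cases) (auto simp: Diff_eq)
  finally show ?thesis
    using assms(1) by (simp add: card_Diff_subset finite_subset)
qed

lemma card_words_zeros_eq:
  assumes "Z \<subseteq> {..<m}" and "q > 0"
  shows "card {u \<in> words m q. zeros u = Z} = (q - 1) ^ (m - card Z)"
proof -
  have "{u \<in> words m q. zeros u = Z}
      = {u \<in> carrier_vec m. \<forall>i<m. u $ i \<in> (if i \<in> Z then {0} else {1..<q})}"
    using assms by (fastforce simp: words_def zeros_def split: if_splits)
  then show ?thesis using card_vec_prescribed[OF assms(1), of "{1..<q}" "\<lambda>_. 0"] by simp
qed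

text \<open>Double counting of the pairs of a word and a position of a zero in it.\<close>

lemma sum_card_zeros:
  assumes "q > 0"
  shows "(\<Sum>u\<in>words m q. card (zeros u)) = m * q ^ (m - 1)"
proof -
  have "(\<Sum>u\<in>words m q. card (zeros u)) = (\<Sum>i<m. card {u \<in> words m q. u $ i = 0})"
  proof -
    have "card (zeros u) = (\<Sum>i<m. if u $ i = 0 then 1 else 0)" if "u \<in> words m q" for u
    proof -
      have "zeros u = {..<m} \<inter> {i. u $ i = 0}" using that by (auto simp: zeros_def words_def)
      then show ?thesis by (simp add: sum.If_cases)
    qed
    then have "(\<Sum>u\<in>words m q. card (zeros u)) = (\<Sum>u\<in>words m q. \<Sum>i<m. if u $ i = 0 then 1 else 0)"
      by (rule sum.cong[OF refl])
    also have "\<dots> = (\<Sum>i<m. \<Sum>u\<in>words m q. if u $ i = 0 then 1 else 0)" by (rule sum.swap)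
    also have "\<dots> = (\<Sum>i<m. card {u \<in> words m q. u $ i = 0})"
      by (simp add: sum.If_cases finite_words Collect_conj_eq)
    finally show ?thesis .
  qed
  also have "\<dots> = (\<Sum>i<m. q ^ (m - 1))"
  proof (rule sum.cong[OF refl])
    fix i assume i: "i \<in> {..<m}"
    have "{u \<in> words m q. u $ i = 0}
        = {u \<in> carrier_vec m. \<forall>k<m. u $ k \<in> (if k \<in> {i} then {0} else {..<q})}"
      using i assms by (fastforce simp: words_def split: if_splits)
    then show "card {u \<in> words m q. u $ i = 0} = q ^ (m - 1)"
      using i card_vec_prescribed[of "{i}" m "{..<q}" "\<lambda>_. 0"] by simp
  qed
  finally show ?thesis by simp
qed

text \<open>Each of the \<open>(q - 1) ^ m\<close> zero-free words falls short of 2 by one. The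
  additive form avoids truncated subtraction.\<close>

lemma sum_if_zeros_empty:
  assumes "q > 0"
  shows "(\<Sum>u\<in>words m q. if zeros u = {} then 1 else 2) + (q - 1) ^ m = 2 * q ^ m"
proof -
  let ?Z = "{u \<in> words m q. zeros u = {}}"
  have Z: "card ?Z = (q - 1) ^ m" using card_words_zeros_eq[of "{}" m q] assms by simp
  have "(\<Sum>u\<in>words m q. if zeros u = {} then 1 else 2) + card ?Z
      = (\<Sum>u\<in>words m q. (if zeros u = {} then 1 else 2) + (if zeros u = {} then 1 else 0))"
    by (simp add: sum.distrib sum.If_cases finite_words Collect_conj_eq)
  also have "\<dots> = (\<Sum>u\<in>words m q. 2)" by (intro sum.cong) auto
  finally show ?thesis by (simp add: Z card_words)
qed

section \<open>Fibers of \<open>lowered\<close> as families of subsets of the zero set\<close>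

lemma card_eq_sum_lowered_fibers:
  assumes "S \<subseteq> words m r" and "r \<ge> 2"
  shows "card S = (\<Sum>u\<in>words m (r - 1). card {v \<in> S. lowered v = u})"
proof -
  have "finite S" using assms(1) finite_words finite_subset by blast
  moreover have "lowered ` S \<subseteq> words m (r - 1)"
    using assms by (fastforce simp: words_def)
  ultimately have "(\<Sum>u\<in>words m (r - 1). \<Sum>v\<in>{v \<in> S. lowered v = u}. 1) = (\<Sum>v\<in>S. 1::nat)"
    by (intro sum.group finite_words)
  then show ?thesis by simp
qed

context
  fixes C :: "nat vec set" and u :: "nat vec" and m :: nat
  assumes dec_eq: "\<And>v. v \<in> C \<Longrightarrow> lowered v = u" and dim: "dim_vec u = m"
begin

private abbreviation "ones v \<equiv> {i. i < m \<and> v $ i = (1::nat)}"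

private lemma fiber_dim: "v \<in> C \<Longrightarrow> dim_vec v = m"
  using dec_eq dim by (metis index_map_vec(2))

private lemma fiber_nth: "v \<in> C \<Longrightarrow> i < m \<Longrightarrow> v $ i - 1 = u $ i"
  using dec_eq fiber_dim by (metis index_map_vec(1))

private lemma fiber_nth_le: "v \<in> C \<Longrightarrow> i \<in> zeros u \<Longrightarrow> v $ i \<le> 1"
  using fiber_nth[of v i] dim by (auto simp: zeros_def)

text \<open>Where \<open>u\<close> is positive the entry of \<open>v\<close> is forced to be one
  larger; where \<open>u\<close> is 0 the entry is 0 or 1. Hence the positions of the ones determine
  \<open>v\<close>.\<close>

private lemma inj_on_ones: "inj_on (\<lambda>v. ones v) C"
proof (rule inj_onI)
  fix v w assume vw: "v \<in> C" "w \<in> C" and eq: "ones v = ones w"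
  show "v = w"
  proof (rule eq_vecI)
    fix i assume "i < dim_vec w"
    then have i: "i < m" using vw fiber_dim by simp
    have "v $ i = 1 \<longleftrightarrow> w $ i = 1" using eq i by blast
    then show "v $ i = w $ i"
      using fiber_nth[OF vw(1) i] fiber_nth[OF vw(2) i] by linarith
  qed (use vw fiber_dim in simp)
qed

private lemma ones_subset: "v \<in> C \<Longrightarrow> ones v \<subseteq> zeros u"
  using fiber_nth dim by (fastforce simp: zeros_def)

text \<open>Passing to the sets of ones turns the fiber into a family of subsets of
  \<open>zeros u\<close>, and a pattern missing at a pair says that the pair is not
  shattered.\<close>

lemma card_fiber_le_Suc_zeros:
  assumes "\<And>i j. i < j \<Longrightarrow> j < m \<Longrightarrow>
    \<exists>x\<in>{0, 1}. \<exists>y\<in>{0, 1}. \<forall>v\<in>C. \<not> (v $ i = x \<and> v $ j = y)"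
  shows "card C \<le> Suc (card (zeros u))"
proof -
  have "card C = card ((\<lambda>v. ones v) ` C)" by (rule card_image[OF inj_on_ones, symmetric])
  also have "\<dots> \<le> Suc (card (zeros u))"
  proof (rule card_le_Suc_if_no_shattered_pair)
    show "(\<lambda>v. ones v) ` C \<subseteq> Pow (zeros u)" using ones_subset by blast
  next
    have ordered: "\<exists>s t. \<forall>A\<in>(\<lambda>v. ones v) ` C. \<not> ((i \<in> A) = s \<and> (j \<in> A) = t)"
      if ij: "i \<in> zeros u" "j \<in> zeros u" "i < j" for i j
    proof -
      have m: "i < m" "j < m" using ij dim by (auto simp: zeros_def)
      obtain x y where xy: "x \<in> {0, 1}" "y \<in> {0, 1}"
        and avoid: "\<forall>v\<in>C. \<not> (v $ i = x \<and> v $ j = y)"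
        using assms[OF ij(3) m(2)] by blast
      \<comment> \<open>At zeros of \<open>u\<close> entries are at most 1, so membership in the set
        of ones determines them.\<close>
      have "\<not> ((v $ i = 1) = (x = 1) \<and> (v $ j = 1) = (y = 1))" if "v \<in> C" for v
        using avoid that xy fiber_nth_le[OF that ij(1)] fiber_nth_le[OF that ij(2)] by force
      then show ?thesis using m by (intro exI[of _ "x = 1"] exI[of _ "y = 1"]) auto
    qed
    fix i j assume ij: "i \<in> zeros u" "j \<in> zeros u" "i \<noteq> j"
    show "\<exists>s t. \<forall>A\<in>(\<lambda>v. ones v) ` C. \<not> ((i \<in> A) = s \<and> (j \<in> A) = t)"
    proof (cases "i < j")
      case True
      then show ?thesis using ordered ij by blast
    next
      case False
      then have "j < i" using ij(3) by simp
      from ordered[OF ij(2,1) this] obtain s t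
        where "\<forall>A\<in>(\<lambda>v. ones v) ` C. \<not> ((j \<in> A) = s \<and> (i \<in> A) = t)"
        by (elim exE) (rule that)
      then have "\<forall>A\<in>(\<lambda>v. ones v) ` C. \<not> ((i \<in> A) = t \<and> (j \<in> A) = s)" by blast
      then show ?thesis by (intro exI)
    qed
  qed simp
  finally show ?thesis .
qed

text \<open>The set of ones can only be empty or all of \<open>zeros u\<close>; these two coincide
  when \<open>u\<close> has no zero.\<close>

lemma card_constant_fiber_le:
  assumes "\<And>v i j. v \<in> C \<Longrightarrow> i \<in> zeros u \<Longrightarrow> j \<in> zeros u \<Longrightarrow> v $ i = v $ j"
  shows "card C \<le> (if zeros u = {} then 1 else 2)"
proof -
  have sub: "(\<lambda>v. ones v) ` C \<subseteq> {{}, zeros u}"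
  proof
    fix A assume "A \<in> (\<lambda>v. ones v) ` C"
    then obtain v where v: "v \<in> C" "A = ones v" by blast
    show "A \<in> {{}, zeros u}"
    proof (cases "A = {}")
      case False
      then obtain i where "i < m" "v $ i = 1" using v by blast
      then have i: "i \<in> zeros u" using ones_subset[OF v(1)] by blast
      have "zeros u \<subseteq> A"
      proof
        fix k assume k: "k \<in> zeros u"
        then have "v $ k = 1" using assms[OF v(1) i k] \<open>v $ i = 1\<close> by simp
        then show "k \<in> A" using k v(2) dim by (simp add: zeros_def)
      qed
      then show ?thesis using ones_subset[OF v(1)] v(2) by blast
    qed simp
  qed
  have "card C = card ((\<lambda>v. ones v) ` C)" by (rule card_image[OF inj_on_ones, symmetric])
  also have "\<dots> \<le> card {{}, zeros u}" using sub by (rule card_mono[rotated]) simp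
  also have "\<dots> = (if zeros u = {} then 1 else 2)" by auto
  finally show ?thesis .
qed

end

section \<open>Upper bounds\<close>

text \<open>Union bound: for each \<open>e\<close> at most \<open>w e\<close> members are deleted as
  bad.\<close>

lemma card_le_undeleted:
  assumes "finite S" and "finite P" and "\<And>e. e \<in> P \<Longrightarrow> card {v \<in> S. bad e v} \<le> (w e :: nat)"
  shows "card S \<le> card {v \<in> S. \<forall>e\<in>P. \<not> bad e v} + (\<Sum>e\<in>P. w e)"
proof -
  have "S = {v \<in> S. \<forall>e\<in>P. \<not> bad e v} \<union> (\<Union>e\<in>P. {v \<in> S. bad e v})" by blast
  then have "card S \<le> card {v \<in> S. \<forall>e\<in>P. \<not> bad e v} + card (\<Union>e\<in>P. {v \<in> S. bad e v})"
    by (metis (no_types, lifting) card_Un_le)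
  also have "card (\<Union>e\<in>P. {v \<in> S. bad e v}) \<le> (\<Sum>e\<in>P. card {v \<in> S. bad e v})"
    using assms(2) by (rule card_UN_le)
  also have "\<dots> \<le> (\<Sum>e\<in>P. w e)" using assms(3) by (rule sum_mono)
  finally show ?thesis by simp
qed

text \<open>Both orders are listed for the case \<open>\<alpha> = 0\<close>, in which 01 is rare in
  either order. For \<open>\<alpha> > 0\<close> each unordered pair is treated once, through
  \<open>increasing_pairs\<close>.\<close>

definition ordered_pairs :: "nat \<Rightarrow> (nat \<times> nat) set" where
  "ordered_pairs m = {(i, j). i < m \<and> j < m \<and> i \<noteq> j}"

definition increasing_pairs :: "nat \<Rightarrow> (nat \<times> nat) set" where
  "increasing_pairs m = {(i, j). i < j \<and> j < m}"

lemma finite_ordered_pairs: "finite (ordered_pairs m)"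
  by (rule finite_subset[of _ "{..<m} \<times> {..<m}"]) (auto simp: ordered_pairs_def)

lemma card_ordered_pairs: "card (ordered_pairs m) = m * (m - 1)"
proof -
  have "ordered_pairs m = (SIGMA i:{..<m}. {..<m} - {i})" by (auto simp: ordered_pairs_def)
  then show ?thesis by simp
qed

lemma finite_increasing_pairs: "finite (increasing_pairs m)"
  by (rule finite_subset[of _ "{..<m} \<times> {..<m}"]) (auto simp: increasing_pairs_def)

lemma card_increasing_pairs: "card (increasing_pairs m) = m choose 2"
proof -
  have "increasing_pairs m = (\<lambda>(j, i). (i, j)) ` (SIGMA j:{..<m}. {..<j})"
    by (auto simp: increasing_pairs_def)
  then have "card (increasing_pairs m) = card (SIGMA j:{..<m}. {..<j})"
    by (simp add: card_image inj_on_def split_beta prod_eq_iff)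
  also have "\<dots> = \<Sum>{..<m}" by simp
  also have "\<dots> = m choose 2"
    by (cases m) (simp_all add: lessThan_Suc_atMost gauss_sum_nat atMost_atLeast0 choose_two)
  finally show ?thesis .
qed

text \<open>The cost \<open>2 * (p - 1)\<close> of an exceptional pair, one in \<open>E\<close>, is
  charged to the \<open>(r - 2) ^ (m - 2)\<close> lowered words whose zero set is exactly that pair;
  \<open>large\<close> says that this suffices.\<close>

lemma card_le_if_rare_pattern:
  assumes S: "S \<subseteq> words m r" and r: "r \<ge> 2" and "\<alpha> \<ge> 1" and large: "(r - 2) ^ (m - 2) \<ge> 2 * p"
    and rare: "\<And>i j. i < j \<Longrightarrow> j < m \<Longrightarrow>
      (\<exists>x\<in>{0, 1}. \<exists>y\<in>{0, 1}. pair_count S i j x y < \<alpha>) \<or>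
      (pair_count S i j 0 1 < p \<and> pair_count S i j 1 0 < p)"
  shows "card S \<le> m * (r - 1) ^ (m - 1) + (r - 1) ^ m + (\<alpha> - 1) * (m choose 2)"
proof -
  let ?P = "increasing_pairs m"
  define E where "E = {(i, j) \<in> ?P. \<not> (\<exists>x\<in>{0, 1}. \<exists>y\<in>{0, 1}. pair_count S i j x y < \<alpha>)}"
  have finS: "finite S" using S finite_words finite_subset by blast
  have "E \<subseteq> ?P" by (auto simp: E_def)
  then have finE: "finite E" using finite_increasing_pairs finite_subset by blast
  have "\<forall>e\<in>?P - E. \<exists>x y. x \<in> {0, 1} \<and> y \<in> {0, 1} \<and> pair_count S (fst e) (snd e) x y < \<alpha>"
  proof
    fix e assume e: "e \<in> ?P - E"
    obtain i j where ij: "e = (i, j)" by (cases e)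
    have "\<exists>x\<in>{0, 1}. \<exists>y\<in>{0, 1}. pair_count S i j x y < \<alpha>"
      using e by (simp add: E_def ij)
    then obtain x y where "x \<in> {0, 1}" "y \<in> {0, 1}" "pair_count S i j x y < \<alpha>" by blast
    then show "\<exists>x y. x \<in> {0, 1} \<and> y \<in> {0, 1} \<and> pair_count S (fst e) (snd e) x y < \<alpha>"
      by (intro exI[of _ x] exI[of _ y]) (simp add: ij)
  qed
  then obtain X Y where XY: "\<And>e. e \<in> ?P - E \<Longrightarrow> X e \<in> {0, 1} \<and> Y e \<in> {0, 1} \<and>
      pair_count S (fst e) (snd e) (X e) (Y e) < \<alpha>"
    by metis
  \<comment> \<open>At an exceptional pair both mixed patterns are deleted, so that surviving words
    with entries 0 or 1 there have equal entries.\<close>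
  define bad where "bad e v \<longleftrightarrow>
    (if e \<in> E then v $ fst e = 0 \<and> v $ snd e = 1 \<or> v $ fst e = 1 \<and> v $ snd e = 0
     else v $ fst e = X e \<and> v $ snd e = Y e)" for e :: "nat \<times> nat" and v :: "nat vec"
  define S\<^sub>0 where "S\<^sub>0 = {v \<in> S. \<forall>e\<in>?P. \<not> bad e v}"
  have S\<^sub>0: "S\<^sub>0 \<subseteq> words m r" using S by (auto simp: S\<^sub>0_def)

  have "card {v \<in> S. bad e v} \<le> (if e \<in> E then 2 * (p - 1) else \<alpha> - 1)" if e: "e \<in> ?P" for e
  proof (cases "e \<in> E")
    case True
    then have "pair_count S (fst e) (snd e) 0 1 < p" "pair_count S (fst e) (snd e) 1 0 < p"
      using rare[of "fst e" "snd e"] by (auto simp: E_def increasing_pairs_def)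
    moreover have "{v \<in> S. bad e v} = {v \<in> S. v $ fst e = 0 \<and> v $ snd e = 1} \<union>
        {v \<in> S. v $ fst e = 1 \<and> v $ snd e = 0}"
      using True by (auto simp: bad_def)
    then have "card {v \<in> S. bad e v} \<le> pair_count S (fst e) (snd e) 0 1 + pair_count S (fst e) (snd e) 1 0"
      unfolding pair_count_def by (metis (no_types, lifting) card_Un_le)
    ultimately show ?thesis using True by simp
  next
    case False
    then have "card {v \<in> S. bad e v} = pair_count S (fst e) (snd e) (X e) (Y e)"
      by (simp add: bad_def pair_count_def)
    with XY[of e] e False show ?thesis by auto
  qed
  then have "card S \<le> card S\<^sub>0 + (\<Sum>e\<in>?P. if e \<in> E then 2 * (p - 1) else \<alpha> - 1)"
    unfolding S\<^sub>0_def by (intro card_le_undeleted finS finite_increasing_pairs)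
  also have "(\<Sum>e\<in>?P. if e \<in> E then 2 * (p - 1) else \<alpha> - 1)
      = card E * (2 * (p - 1)) + card (?P - E) * (\<alpha> - 1)"
    using \<open>E \<subseteq> ?P\<close> by (simp add: sum.If_cases finite_increasing_pairs Int_absorb1 Diff_eq)
  also have "\<dots> \<le> card E * (r - 2) ^ (m - 2) + (m choose 2) * (\<alpha> - 1)"
    using large card_mono[OF finite_increasing_pairs, of "?P - E" m]
    by (intro add_mono mult_le_mono) (auto simp: card_increasing_pairs)
  finally have "card S \<le> card S\<^sub>0 + card E * (r - 2) ^ (m - 2) + (m choose 2) * (\<alpha> - 1)" by simp

  moreover have "card S\<^sub>0 + card E * (r - 2) ^ (m - 2) \<le> m * (r - 1) ^ (m - 1) + (r - 1) ^ m"
  proof -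
    let ?U = "words m (r - 1)"
    \<comment> \<open>The second summand is the saving, 0 or 1. If it is 1, then
      \<open>zeros u\<close> has two elements, and the fiber, being constant on them, has at most 2
      members instead of 3.\<close>
    have fiber: "card {v \<in> S\<^sub>0. lowered v = u} + card {e \<in> E. zeros u = {fst e, snd e}} \<le> Suc (card (zeros u))"
      if u: "u \<in> ?U" for u
    proof (cases "{e \<in> E. zeros u = {fst e, snd e}} = {}")
      case True
      have "card {v \<in> S\<^sub>0. lowered v = u} \<le> Suc (card (zeros u))"
      proof (rule card_fiber_le_Suc_zeros[where m = m])
        fix i j :: nat assume ij: "i < j" "j < m"
        then have P: "(i, j) \<in> ?P" by (simp add: increasing_pairs_def)
        show "\<exists>x\<in>{0, 1}. \<exists>y\<in>{0, 1}. \<forall>v\<in>{v \<in> S\<^sub>0. lowered v = u}. \<not> (v $ i = x \<and> v $ j = y)"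
        proof (cases "(i, j) \<in> E")
          case True
          \<comment> \<open>Both 01 and 10 are gone at an exceptional pair; either would serve as
            the missing pattern.\<close>
          then show ?thesis using P by (intro bexI[of _ 0] bexI[of _ 1]) (auto simp: S\<^sub>0_def bad_def)
        next
          case False
          then show ?thesis using P XY[of "(i, j)"]
            by (intro bexI[of _ "X (i, j)"] bexI[of _ "Y (i, j)"]) (auto simp: S\<^sub>0_def bad_def)
        qed
      qed (use u in \<open>auto simp: words_def\<close>)
      then show ?thesis unfolding True by simp
    next
      case False
      then obtain e where e: "e \<in> E" "zeros u = {fst e, snd e}" by blast
      then have P: "e \<in> ?P" and lt: "fst e < snd e"
        using \<open>E \<subseteq> ?P\<close> by (auto simp: increasing_pairs_def)
      \<comment> \<open>An increasing pair is determined by its set of components.\<close>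
      have "{e \<in> E. zeros u = {fst e, snd e}} \<subseteq> {e}"
        using e lt \<open>E \<subseteq> ?P\<close> by (fastforce simp: increasing_pairs_def doubleton_eq_iff)
      then have "card {e \<in> E. zeros u = {fst e, snd e}} \<le> 1" using card_mono[of "{e}"] by simp
      moreover have "card {v \<in> S\<^sub>0. lowered v = u} \<le> (if zeros u = {} then 1 else 2)"
      proof (rule card_constant_fiber_le[where m = m])
        fix v i j assume v: "v \<in> {v \<in> S\<^sub>0. lowered v = u}" and ij: "i \<in> zeros u" "j \<in> zeros u"
        have le: "v $ k \<le> 1" if "k \<in> zeros u" for k
          using v that u by (auto simp: zeros_def words_def)
        have "v $ fst e \<le> 1" "v $ snd e \<le> 1" using le e(2) by simp_all
        moreover have "\<not> bad e v" using v P by (auto simp: S\<^sub>0_def)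
        ultimately have "v $ fst e = v $ snd e"
          using e(1) by (auto simp: bad_def le_Suc_eq)
        then show "v $ i = v $ j" using ij e(2) by auto
      qed (use u in \<open>auto simp: words_def\<close>)
      moreover have "card (zeros u) = 2" using e(2) lt by simp
      ultimately show ?thesis using e(2) by simp
    qed
    \<comment> \<open>Counting the savings by pairs instead of by words gives the total needed for
      the extra deletions.\<close>
    have "(\<Sum>u\<in>?U. card {e \<in> E. zeros u = {fst e, snd e}})
        = (\<Sum>e\<in>E. card {u \<in> ?U. zeros u = {fst e, snd e}})"
      using sum.swap_restrict[OF finite_words finE,
          where g = "\<lambda>_ _. 1::nat" and R = "\<lambda>u e. zeros u = {fst e, snd e}"]
      by simp
    also have "\<dots> = (\<Sum>e\<in>E. (r - 2) ^ (m - 2))"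
    proof (rule sum.cong[OF refl])
      fix e assume "e \<in> E"
      then have "{fst e, snd e} \<subseteq> {..<m}" "card {fst e, snd e} = 2"
        using \<open>E \<subseteq> ?P\<close> by (auto simp: increasing_pairs_def)
      then show "card {u \<in> ?U. zeros u = {fst e, snd e}} = (r - 2) ^ (m - 2)"
        using card_words_zeros_eq[of "{fst e, snd e}" m "r - 1"] r by (simp add: numeral_2_eq_2)
    qed
    finally have "card E * (r - 2) ^ (m - 2) = (\<Sum>u\<in>?U. card {e \<in> E. zeros u = {fst e, snd e}})"
      by simp
    then have "card S\<^sub>0 + card E * (r - 2) ^ (m - 2) =
        (\<Sum>u\<in>?U. card {v \<in> S\<^sub>0. lowered v = u} + card {e \<in> E. zeros u = {fst e, snd e}})"
      by (simp add: card_eq_sum_lowered_fibers[OF S\<^sub>0 r] sum.distrib)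
    also have "\<dots> \<le> (\<Sum>u\<in>?U. card (zeros u) + 1)" using fiber by (intro sum_mono) simp
    also have "\<dots> = m * (r - 1) ^ (m - 1) + (r - 1) ^ m"
      using r by (simp only: sum.distrib sum_card_zeros) (simp add: sum_card_zeros card_words)
    finally show ?thesis .
  qed
  ultimately show ?thesis by (simp add: mult.commute)
qed

text \<open>Deleting 01 at every ordered pair removes both mixed patterns, so each remaining word is
  constant on the zeros of its lowered word. The \<open>(r - 2) ^ m\<close> zero-free lowered words,
  with fibers of at most one member, account for the term on the left.\<close>

lemma card_le_if_rare_01:
  assumes S: "S \<subseteq> words m r" and r: "r \<ge> 2"
    and rare: "\<And>i j. i < m \<Longrightarrow> j < m \<Longrightarrow> i \<noteq> j \<Longrightarrow> pair_count S i j 0 1 < p"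
  shows "card S + (r - 2) ^ m \<le> 2 * (r - 1) ^ m + (p - 1) * (m * (m - 1))"
proof -
  let ?P = "ordered_pairs m"
  define bad where "bad = (\<lambda>(i, j) v. v $ i = (0::nat) \<and> v $ j = (1::nat))"
  define S\<^sub>0 where "S\<^sub>0 = {v \<in> S. \<forall>e\<in>?P. \<not> bad e v}"
  have finS: "finite S" using S finite_words finite_subset by blast
  have S\<^sub>0: "S\<^sub>0 \<subseteq> words m r" using S by (auto simp: S\<^sub>0_def)
  have "card {v \<in> S. bad e v} \<le> p - 1" if "e \<in> ?P" for e
    using that rare[of "fst e" "snd e"]
    by (auto simp: ordered_pairs_def bad_def pair_count_def)
  then have "card S \<le> card S\<^sub>0 + (\<Sum>e\<in>?P. p - 1)"
    unfolding S\<^sub>0_def by (intro card_le_undeleted finS finite_ordered_pairs)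
  moreover have "card S\<^sub>0 \<le> (\<Sum>u\<in>words m (r - 1). if zeros u = {} then 1 else 2)"
    unfolding card_eq_sum_lowered_fibers[OF S\<^sub>0 r]
  proof (rule sum_mono)
    fix u assume u: "u \<in> words m (r - 1)"
    show "card {v \<in> S\<^sub>0. lowered v = u} \<le> (if zeros u = {} then 1 else 2)"
    proof (rule card_constant_fiber_le[where m = m])
      fix v i j assume v: "v \<in> {v \<in> S\<^sub>0. lowered v = u}" and ij: "i \<in> zeros u" "j \<in> zeros u"
      have m: "i < m" "j < m" using ij u by (auto simp: zeros_def words_def)
      have le: "v $ k \<le> 1" if "k \<in> zeros u" for k
        using v that u by (auto simp: zeros_def words_def)
      show "v $ i = v $ j"
      proof (rule ccontr)
        assume "v $ i \<noteq> v $ j"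
        then have "i \<noteq> j" and "bad (i, j) v \<or> bad (j, i) v"
          using le[OF ij(1)] le[OF ij(2)] by (auto simp: bad_def le_Suc_eq)
        then show False using v m by (auto simp: S\<^sub>0_def ordered_pairs_def)
      qed
    qed (use u in \<open>auto simp: words_def\<close>)
  qed
  ultimately show ?thesis
    using sum_if_zeros_empty[of "r - 1" m] r
    by (simp add: card_ordered_pairs numeral_2_eq_2 mult.commute)
qed

section \<open>Families with a rare pattern for every pair\<close>

text \<open>A word with the pattern at \<open>e\<close> and entries at least 2 elsewhere has the
  pattern at no other pair of \<open>P\<close>, so \<open>t - 1\<close> such words can be added for
  each pair independently. If \<open>x = y\<close>, a pair and its reverse carry the same pattern,
  hence \<open>asym\<close>.\<close>

lemma obtain_family_with_rare_pattern:
  assumes P: "P \<subseteq> ordered_pairs m" and asym: "x \<noteq> y \<or> P \<inter> converse P = {}"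
    and xy: "x < 2" "y < 2" and r: "r \<ge> 2" and t: "t \<ge> 1" "t - 1 \<le> (r - 2) ^ (m - 2)"
  obtains S where "S \<subseteq> words m r"
    and "card S = card {v \<in> words m r. \<forall>(i, j)\<in>P. \<not> (v $ i = x \<and> v $ j = y)} + card P * (t - 1)"
    and "\<And>i j. (i, j) \<in> P \<Longrightarrow> pair_count S i j x y < t"
proof -
  let ?B = "{v \<in> words m r. \<forall>(i, j)\<in>P. \<not> (v $ i = x \<and> v $ j = y)}"
  define Q where "Q e = {v \<in> carrier_vec m. \<forall>k<m. v $ k \<in>
      (if k \<in> {fst e, snd e} then {if k = fst e then x else y} else {2..<r})}" for e
  have finP: "finite P" using P finite_ordered_pairs finite_subset by blast
  have Pd: "fst e < m" "snd e < m" "fst e \<noteq> snd e" if "e \<in> P" for e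
    using P that by (auto simp: ordered_pairs_def)
  have card_Q: "card (Q e) = (r - 2) ^ (m - 2)" if "e \<in> P" for e
    using card_vec_prescribed[of "{fst e, snd e}" m "{2..<r}" "\<lambda>k. if k = fst e then x else y"] Pd[OF that]
    by (simp add: Q_def numeral_2_eq_2)
  have "\<forall>e\<in>P. \<exists>G. G \<subseteq> Q e \<and> card G = t - 1 \<and> finite G"
  proof
    fix e assume "e \<in> P"
    then have "t - 1 \<le> card (Q e)" using card_Q t(2) by simp
    then show "\<exists>G. G \<subseteq> Q e \<and> card G = t - 1 \<and> finite G"
      by (rule obtain_subset_with_card_n) blast
  qed
  from bchoice[OF this] obtain G where G: "\<forall>e\<in>P. G e \<subseteq> Q e \<and> card (G e) = t - 1 \<and> finite (G e)" ..
  have Q_words: "v \<in> words m r" if "v \<in> Q e" for v e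
  proof -
    have "v $ k < r" if "k < m" for k
    proof -
      have "v $ k \<in> (if k \<in> {fst e, snd e} then {if k = fst e then x else y} else {2..<r})"
        using \<open>v \<in> Q e\<close> \<open>k < m\<close> unfolding Q_def by blast
      then show ?thesis using xy r by (auto split: if_splits)
    qed
    then show ?thesis using that by (simp add: words_def Q_def)
  qed
  have Q_pattern: "v $ fst e = x" "v $ snd e = y" if "e \<in> P" "v \<in> Q e" for v e
    using Pd[OF that(1)] that(2) by (auto simp: Q_def)
  \<comment> \<open>The entries below 2 of \<open>v\<close> lie at the two positions of
    \<open>f\<close>, so \<open>e\<close> is \<open>f\<close> or its reverse; the reverse forces
    \<open>x = y\<close>, which \<open>asym\<close> rules out.\<close>
  have Q_unique: "e = f" if e: "e \<in> P" and f: "f \<in> P" and v: "v \<in> Q f"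
    and pat: "v $ fst e = x" "v $ snd e = y" for e f v
  proof -
    have in_f: "k \<in> {fst f, snd f}" if "k < m" "v $ k < 2" for k
    proof (rule ccontr)
      assume "k \<notin> {fst f, snd f}"
      moreover have "v $ k \<in> (if k \<in> {fst f, snd f} then {if k = fst f then x else y} else {2..<r})"
        using v that(1) unfolding Q_def by blast
      ultimately show False using that(2) by simp
    qed
    have sub: "fst e \<in> {fst f, snd f}" "snd e \<in> {fst f, snd f}"
      using in_f Pd[OF e] pat xy by auto
    show ?thesis
    proof (cases "fst e = fst f")
      case True
      then show ?thesis using sub Pd[OF e] by (auto simp: prod_eq_iff)
    next
      case False
      then have swap: "e = (snd f, fst f)" using sub Pd[OF e] by (auto simp: prod_eq_iff)
      then have "x = y" using pat Q_pattern[OF f v] by simp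
      moreover have "f \<in> P \<inter> converse P" using swap e f by (cases f) simp
      ultimately show ?thesis using asym by blast
    qed
  qed
  define S where "S = ?B \<union> (\<Union>e\<in>P. G e)"
  have "G e \<subseteq> words m r" if "e \<in> P" for e using G Q_words that by blast
  then have "S \<subseteq> words m r" unfolding S_def by blast
  moreover have "card S = card ?B + card P * (t - 1)"
  proof -
    have disj: "?B \<inter> (\<Union>e\<in>P. G e) = {}"
    proof (rule ccontr)
      assume "?B \<inter> (\<Union>e\<in>P. G e) \<noteq> {}"
      then obtain v e where ve: "v \<in> ?B" "e \<in> P" "v \<in> G e" by blast
      then have "v \<in> Q e" using G by blast
      then show False using Q_pattern[OF ve(2)] ve(1,2) by (auto simp: split_beta)
    qed
    have "G e \<inter> G f = {}" if "e \<in> P" "f \<in> P" "e \<noteq> f" for e f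
    proof (rule ccontr)
      assume "G e \<inter> G f \<noteq> {}"
      then obtain v where "v \<in> G e" "v \<in> G f" by blast
      then have "v \<in> Q e" "v \<in> Q f" using G that(1,2) by blast+
      then show False
        using Q_unique[OF that(1,2), of v] Q_pattern[OF that(1), of v] that(3) by simp
    qed
    then have "card (\<Union>e\<in>P. G e) = (\<Sum>e\<in>P. card (G e))"
      using G finP by (intro card_UN_disjoint) auto
    also have "\<dots> = card P * (t - 1)" using G by simp
    finally have "card (\<Union>e\<in>P. G e) = card P * (t - 1)" .
    moreover have "finite (\<Union>e\<in>P. G e)" using G finP by blast
    moreover have "finite ?B" using finite_words by simp
    ultimately show ?thesis unfolding S_def using disj by (simp add: card_Un_disjoint)
  qed
  moreover have "pair_count S i j x y < t" if ij: "(i, j) \<in> P" for i j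
  proof -
    \<comment> \<open>Words of \<open>?B\<close> never have the pattern, and by
      \<open>Q_unique\<close> an added word has it only at its own pair.\<close>
    have "{v \<in> S. v $ i = x \<and> v $ j = y} \<subseteq> G (i, j)"
    proof
      fix v assume v: "v \<in> {v \<in> S. v $ i = x \<and> v $ j = y}"
      then have "v \<notin> ?B" using ij by blast
      then obtain f where f: "f \<in> P" "v \<in> G f" using v by (auto simp: S_def)
      then have "v \<in> Q f" using G by blast
      then have "(i, j) = f" using Q_unique[OF ij f(1)] v by simp
      then show "v \<in> G (i, j)" using f(2) by simp
    qed
    moreover have "finite (G (i, j))" "card (G (i, j)) = t - 1" using G ij by blast+
    ultimately have "pair_count S i j x y \<le> t - 1"
      unfolding pair_count_def using card_mono[of "G (i, j)"] by simp
    then show ?thesis using t(1) by simp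
  qed
  ultimately show ?thesis by (rule that)
qed

section \<open>Lower bounds for fibers by explicit fillings\<close>

text \<open>A right inverse of \<open>lowered\<close> for 0-1 valued \<open>\<chi>\<close>, which
  chooses between 0 and 1 at the zeros of \<open>u\<close>.\<close>

definition fill :: "nat vec \<Rightarrow> (nat \<Rightarrow> nat) \<Rightarrow> nat vec" where
  "fill u \<chi> = vec (dim_vec u) (\<lambda>k. if u $ k = 0 then \<chi> k else u $ k + 1)"

lemma fill_in_words:
  assumes "u \<in> words m (r - 1)" and "\<And>k. \<chi> k < 2" and "r \<ge> 2"
  shows "fill u \<chi> \<in> words m r"
proof -
  have "fill u \<chi> $ k < r" if "k < m" for k
    using assms(1) assms(2)[of k] assms(3) that by (fastforce simp: words_def fill_def)
  moreover have "fill u \<chi> \<in> carrier_vec m" using assms(1) by (auto simp: words_def fill_def)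
  ultimately show ?thesis by (simp add: words_def)
qed

lemma fill_less_2_iff: "\<lbrakk>\<And>k. \<chi> k < 2; i < dim_vec u; x < 2\<rbrakk> \<Longrightarrow> fill u \<chi> $ i = x \<longleftrightarrow> u $ i = 0 \<and> \<chi> i = x"
  by (auto simp: fill_def)

text \<open>\<open>fill\<close> sees \<open>\<chi>\<close> only at zeros of \<open>u\<close>, so
  fillings are distinct once the assignments differ at some zero.\<close>

lemma card_fiber_ge:
  assumes "finite B" and bin: "\<And>q k. q \<in> K \<Longrightarrow> \<chi> q k < 2"
    and "\<And>q. q \<in> K \<Longrightarrow> fill u (\<chi> q) \<in> B"
    and sep: "\<And>q p. q \<in> K \<Longrightarrow> p \<in> K \<Longrightarrow> q \<noteq> p \<Longrightarrow> \<exists>k\<in>zeros u. \<chi> q k \<noteq> \<chi> p k"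
  shows "card K \<le> card {v \<in> B. lowered v = u}"
proof (rule card_inj_on_le[of "\<lambda>q. fill u (\<chi> q)"])
  show "inj_on (\<lambda>q. fill u (\<chi> q)) K"
  proof (rule inj_onI, rule ccontr)
    fix q p assume op: "q \<in> K" "p \<in> K" and eq: "fill u (\<chi> q) = fill u (\<chi> p)" and "q \<noteq> p"
    then obtain k where "k \<in> zeros u" "\<chi> q k \<noteq> \<chi> p k" using sep by blast
    then show False using arg_cong[OF eq, of "\<lambda>v. v $ k"] by (simp add: zeros_def fill_def)
  qed
  have "lowered (fill u (\<chi> q)) = u" if "q \<in> K" for q
  proof (rule eq_vecI)
    fix k assume "k < dim_vec u"
    then show "lowered (fill u (\<chi> q)) $ k = u $ k"
      using bin[OF that, of k] by (auto simp: fill_def)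
  qed (simp add: fill_def)
  then show "(\<lambda>q. fill u (\<chi> q)) ` K \<subseteq> {v \<in> B. lowered v = u}" using assms(3) by blast
qed (use assms(1) in simp)

text \<open>Over each \<open>u\<close> there are \<open>card (zeros u) + 1\<close> pattern-free
  fillings, so the bound for families shattering no pair is attained in every fiber at once.\<close>

lemma card_pattern_free_words_ge:
  assumes xy: "x < 2" "y < 2" and r: "r \<ge> 2"
  shows "m * (r - 1) ^ (m - 1) + (r - 1) ^ m
    \<le> card {v \<in> words m r. \<forall>(i, j)\<in>increasing_pairs m. \<not> (v $ i = x \<and> v $ j = y)}"
    (is "_ \<le> card ?B")
proof -
  let ?U = "words m (r - 1)"
  \<comment> \<open>the 0-1 words on the zero set that avoid \<open>(x, y)\<close> on increasing pairs: everything is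
    \<open>1 - x\<close>, or there is a first \<open>x\<close>, which can only be followed by \<open>1 - y\<close>\<close>
  define \<chi> where "\<chi> q k = (case q of None \<Rightarrow> 1 - x
      | Some l \<Rightarrow> if k < l then 1 - x else if k = l then x else 1 - y)" for q :: "nat option" and k
  have bin: "\<chi> q k < 2" for q k using xy by (auto simp: \<chi>_def split: option.splits)
  have free: "\<not> (\<chi> q i = x \<and> \<chi> q j = y)" if "i < j" for q i j
    using xy that by (auto simp: \<chi>_def less_2_cases_iff split: option.splits if_splits)
  have "m * (r - 1) ^ (m - 1) + (r - 1) ^ m = (\<Sum>u\<in>?U. card (zeros u) + 1)"
    using sum_card_zeros[of "r - 1" m] r by (simp only: sum.distrib) (simp add: card_words)
  also have "\<dots> \<le> (\<Sum>u\<in>?U. card {v \<in> ?B. lowered v = u})"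
  proof (rule sum_mono)
    fix u assume u: "u \<in> ?U"
    have dim: "dim_vec u = m" using u by (auto simp: words_def)
    let ?K = "insert None (Some ` zeros u)"
    have "card ?K = card (zeros u) + 1" by (simp add: card_image card_insert_if image_iff)
    moreover have "card ?K \<le> card {v \<in> ?B. lowered v = u}"
    proof (rule card_fiber_ge)
      show "finite ?B" using finite_words by simp
      show "\<chi> q k < 2" for q k by (rule bin)
      show "fill u (\<chi> q) \<in> ?B" if "q \<in> ?K" for q
      proof -
        have "\<not> (fill u (\<chi> q) $ i = x \<and> fill u (\<chi> q) $ j = y)" if "i < j" "j < m" for i j
          using free[OF that(1), of q] that dim xy bin by (simp add: fill_less_2_iff)
        then show ?thesis using fill_in_words[OF u, of "\<chi> q"] bin r by (auto simp: increasing_pairs_def)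
      qed
      have neq: "1 - x \<noteq> x" using xy by (auto simp: less_2_cases_iff)
      have None: "\<chi> None l \<noteq> \<chi> (Some l) l" for l using neq by (simp add: \<chi>_def)
      \<comment> \<open>The smaller index separates: one assignment has its first \<open>x\<close>
        there, the other still has \<open>1 - x\<close>.\<close>
      have Some: "\<chi> (Some k) k \<noteq> \<chi> (Some l) k" if "k < l" for k l
        using neq that by (simp add: \<chi>_def)
      show "\<exists>k\<in>zeros u. \<chi> q k \<noteq> \<chi> p k" if op: "q \<in> ?K" "p \<in> ?K" "q \<noteq> p" for q p
      proof (cases q)
        case q: None
        then obtain l where "p = Some l" "l \<in> zeros u" using op by auto
        then show ?thesis using None[of l] q by auto
      next
        case q: (Some k)
        then have k: "k \<in> zeros u" using op by auto
        show ?thesis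
        proof (cases p)
          case None
          then show ?thesis using \<open>\<And>l. \<chi> None l \<noteq> \<chi> (Some l) l\<close>[of k] q k by (intro bexI[of _ k]) auto
        next
          case p: (Some l)
          then have l: "l \<in> zeros u" and "k \<noteq> l" using op q by auto
          then consider "k < l" | "l < k" by linarith
          then show ?thesis
          proof cases
            case 1
            then show ?thesis using Some[of k l] q p k by (intro bexI[of _ k]) auto
          next
            case 2
            then show ?thesis using Some[of l k] q p l by (intro bexI[of _ l]) auto
          qed
        qed
      qed
    qed
    ultimately show "card (zeros u) + 1 \<le> card {v \<in> ?B. lowered v = u}" by simp
  qed
  also have "\<dots> = card ?B" using r by (intro card_eq_sum_lowered_fibers[symmetric]) auto
  finally show ?thesis .
qed

text \<open>Filling all zeros with 0, or all with 1, creates no 01 in any order. The two fillings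
  coincide for the \<open>(r - 2) ^ m\<close> words without zeros.\<close>

lemma card_01_free_words_ge:
  assumes r: "r \<ge> 2"
  shows "2 * (r - 1) ^ m
    \<le> card {v \<in> words m r. \<forall>(i, j)\<in>ordered_pairs m. \<not> (v $ i = 0 \<and> v $ j = 1)} + (r - 2) ^ m"
    (is "_ \<le> card ?B + _")
proof -
  let ?U = "words m (r - 1)"
  have "(\<Sum>u\<in>?U. if zeros u = {} then 1 else 2) \<le> (\<Sum>u\<in>?U. card {v \<in> ?B. lowered v = u})"
  proof (rule sum_mono)
    fix u assume u: "u \<in> ?U"
    have dim: "dim_vec u = m" using u by (auto simp: words_def)
    let ?K = "if zeros u = {} then {0} else {0, 1::nat}"
    have "card ?K \<le> card {v \<in> ?B. lowered v = u}"
    proof (rule card_fiber_ge[where \<chi> = "\<lambda>q _. q"])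
      show "finite ?B" using finite_words by simp
      show bin: "q < 2" if "q \<in> ?K" for q using that by (auto split: if_splits)
      show "fill u (\<lambda>_. q) \<in> ?B" if "q \<in> ?K" for q
      proof -
        have "\<not> (fill u (\<lambda>_. q) $ i = 0 \<and> fill u (\<lambda>_. q) $ j = 1)" if "i < m" "j < m" for i j
          using bin[OF \<open>q \<in> ?K\<close>] that dim by (auto simp: fill_less_2_iff)
        then show ?thesis using fill_in_words[OF u, of "\<lambda>_. q"] bin[OF that] r
          by (auto simp: ordered_pairs_def)
      qed
      show "\<exists>k\<in>zeros u. q \<noteq> p" if "q \<in> ?K" "p \<in> ?K" "q \<noteq> p" for q p
        using that by (auto split: if_splits)
    qed
    then show "(if zeros u = {} then 1 else 2) \<le> card {v \<in> ?B. lowered v = u}"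
      by (simp split: if_splits)
  qed
  also have "\<dots> = card ?B" using r by (intro card_eq_sum_lowered_fibers[symmetric]) auto
  finally show ?thesis using sum_if_zeros_empty[of "r - 1" m] r by (simp add: numeral_2_eq_2)
qed

section \<open>The extremal numbers\<close>

text \<open>The construction makes 00, 11 or 01 rare, according to which of \<open>a\<close>,
  \<open>d\<close>, \<open>min b c\<close> attains \<open>\<alpha>\<close>. In the last case 01 is
  rare for increasing pairs only; read in the reverse order this makes 10 rare, and
  \<open>min b c\<close> lies below both \<open>c\<close> and \<open>b\<close>.\<close>

lemma forb_F_abcd:
  assumes r: "r \<ge> 2" and \<alpha>: "\<alpha> = max a (max d (min b c))" "\<alpha> > 0"
    and large: "(r - 2) ^ (m - 2) \<ge> 2 * max \<alpha> (max b c)"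
  shows "forb m r (F_abcd a b c d) = m * (r - 1) ^ (m - 1) + (r - 1) ^ m + (\<alpha> - 1) * (m choose 2)"
    (is "_ = ?N")
proof -
  obtain x y :: nat where xy: "x < 2" "y < 2"
    and pattern: "x = 0 \<and> y = 0 \<and> \<alpha> = a \<or> x = 1 \<and> y = 1 \<and> \<alpha> = d \<or> x = 0 \<and> y = 1 \<and> \<alpha> = min b c"
  proof -
    have "\<alpha> = a \<or> \<alpha> = d \<or> \<alpha> = min b c" unfolding \<alpha>(1) by (auto simp: max_def)
    then show thesis using that[of 0 0] that[of 1 1] that[of 0 1] by auto
  qed
  have P: "increasing_pairs m \<subseteq> ordered_pairs m"
    by (auto simp: increasing_pairs_def ordered_pairs_def)
  have asym: "x \<noteq> y \<or> increasing_pairs m \<inter> converse (increasing_pairs m) = {}"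
    by (auto simp: increasing_pairs_def)
  have t: "\<alpha> \<ge> 1" "\<alpha> - 1 \<le> (r - 2) ^ (m - 2)" using large \<alpha>(2) by linarith+
  obtain S where S: "S \<subseteq> words m r"
    "card S = card {v \<in> words m r. \<forall>(i, j)\<in>increasing_pairs m. \<not> (v $ i = x \<and> v $ j = y)}
      + card (increasing_pairs m) * (\<alpha> - 1)"
    and rare: "\<And>i j. (i, j) \<in> increasing_pairs m \<Longrightarrow> pair_count S i j x y < \<alpha>"
    by (rule obtain_family_with_rare_pattern[OF P asym xy r t]) (rule that)
  show ?thesis
  proof (rule forb_F_abcd_eqI)
    fix T assume T: "T \<subseteq> words m r"
      and avoid: "\<And>i j. i < m \<Longrightarrow> j < m \<Longrightarrow> i \<noteq> j \<Longrightarrow>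
         pair_count T i j 0 0 < a \<or> pair_count T i j 1 0 < b \<or>
         pair_count T i j 0 1 < c \<or> pair_count T i j 1 1 < d"
    show "card T \<le> ?N"
    proof (rule card_le_if_rare_pattern[OF T r, where p = "max b c"])
      fix i j assume "i < j" "j < m"
      then have ij: "pair_count T i j 0 0 < a \<or> pair_count T i j 1 0 < b \<or>
          pair_count T i j 0 1 < c \<or> pair_count T i j 1 1 < d"
        and ji: "pair_count T i j 0 0 < a \<or> pair_count T i j 0 1 < b \<or>
          pair_count T i j 1 0 < c \<or> pair_count T i j 1 1 < d"
        using avoid[of i j] avoid[of j i] by (simp_all add: pair_count_swap[of T j i])
      \<comment> \<open>If neither 00 nor 11 is rare, each order makes 01 or 10 rare. If both orders
        name the same pattern, it occurs fewer than \<open>min b c\<close> times; otherwise both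
        mixed patterns stay below the same one of \<open>b\<close> and \<open>c\<close>, hence below
        \<open>max b c\<close>.\<close>
      have "pair_count T i j 0 0 < \<alpha> \<or> pair_count T i j 1 1 < \<alpha> \<or> pair_count T i j 0 1 < \<alpha> \<or>
          pair_count T i j 1 0 < \<alpha> \<or> (pair_count T i j 0 1 < max b c \<and> pair_count T i j 1 0 < max b c)"
        using ij ji unfolding \<alpha>(1) by linarith
      then show "(\<exists>x\<in>{0, 1}. \<exists>y\<in>{0, 1}. pair_count T i j x y < \<alpha>) \<or>
          (pair_count T i j 0 1 < max b c \<and> pair_count T i j 1 0 < max b c)"
        by auto
    qed (use \<alpha>(2) large in auto)
  next
    show "S \<subseteq> words m r" by (rule S(1))
    show "?N \<le> card S"
      using card_pattern_free_words_ge[OF xy r, of m] S(2) by (simp add: card_increasing_pairs mult.commute)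
  next
    fix i j assume ij: "i < m" "j < m" "i \<noteq> j"
    then consider "(i, j) \<in> increasing_pairs m" | "(j, i) \<in> increasing_pairs m"
      by (auto simp: increasing_pairs_def neq_iff)
    then show "pair_count S i j 0 0 < a \<or> pair_count S i j 1 0 < b \<or>
         pair_count S i j 0 1 < c \<or> pair_count S i j 1 1 < d"
    proof cases
      case 1
      from rare[OF this] pattern show ?thesis by auto
    next
      case 2
      from rare[OF this] pattern show ?thesis by (auto simp: pair_count_swap[of S j i])
    qed
  qed
qed

text \<open>The construction is applied to all ordered pairs, which is admissible because 01 is not
  symmetric.\<close>

lemma forb_copies_col01:
  assumes r: "r \<ge> 2" and p: "p > 0" and large: "(r - 2) ^ (m - 2) \<ge> 2 * p"
  shows "forb m r (copies p col01) = 2 * (r - 1) ^ m - (r - 2) ^ m + (p - 1) * (m * (m - 1))"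
    (is "_ = ?N")
proof -
  have t: "p \<ge> 1" "p - 1 \<le> (r - 2) ^ (m - 2)" using p large by linarith+
  obtain S where S: "S \<subseteq> words m r"
    "card S = card {v \<in> words m r. \<forall>(i, j)\<in>ordered_pairs m. \<not> (v $ i = 0 \<and> v $ j = 1)}
      + card (ordered_pairs m) * (p - 1)"
    and rare: "\<And>i j. (i, j) \<in> ordered_pairs m \<Longrightarrow> pair_count S i j 0 1 < p"
    by (rule obtain_family_with_rare_pattern[OF subset_refl[of "ordered_pairs m"] _ _ _ r t, of 0 1])
      (simp, simp, simp, rule that)
  \<comment> \<open>Ensures that the natural subtraction in the formula is not truncated.\<close>
  have le: "(r - 2) ^ m \<le> 2 * (r - 1) ^ m"
    using power_mono[of "r - 2" "r - 1" m] by linarith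
  show ?thesis
    unfolding copies_col01
  proof (rule forb_F_abcd_eqI)
    fix T assume T: "T \<subseteq> words m r"
      and avoid: "\<And>i j. i < m \<Longrightarrow> j < m \<Longrightarrow> i \<noteq> j \<Longrightarrow>
         pair_count T i j 0 0 < 0 \<or> pair_count T i j 1 0 < 0 \<or>
         pair_count T i j 0 1 < p \<or> pair_count T i j 1 1 < 0"
    have "card T + (r - 2) ^ m \<le> 2 * (r - 1) ^ m + (p - 1) * (m * (m - 1))"
      using avoid by (intro card_le_if_rare_01[OF T r]) simp
    then show "card T \<le> ?N" using le by linarith
  next
    show "S \<subseteq> words m r" by (rule S(1))
    show "?N \<le> card S"
      using card_01_free_words_ge[OF r, of m] S(2) by (simp add: card_ordered_pairs mult.commute)
  next
    fix i j assume "i < m" "j < m" "i \<noteq> j"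
    then show "pair_count S i j 0 0 < 0 \<or> pair_count S i j 1 0 < 0 \<or>
         pair_count S i j 0 1 < p \<or> pair_count S i j 1 1 < 0"
      using rare[of i j] by (simp add: ordered_pairs_def)
  qed
qed

theorem theorem6p2:
  fixes r m a b c d \<alpha> :: nat
  assumes "r > 3" and "m \<ge> 2"
    and "\<not> (a = 0 \<and> b = 0 \<and> c = 0 \<and> d = 0)"
    and "\<alpha> = Max {a, d, min b c}"
    and "(r - 2) ^ (m - 2) \<ge> 2 * Max {a, b, c, d}"
  shows "(\<alpha> > 0 \<longrightarrow>
            int (forb m r (F_abcd a b c d)) =
              int m * (int r - 1) ^ (m - 1) + (int r - 1) ^ m + (int \<alpha> - 1) * int (m choose 2)) \<and>
         (\<not> \<alpha> > 0 \<longrightarrow>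
            (a = 0 \<and> d = 0 \<and> min b c = 0) \<and>
            row_col_perm (F_abcd a b c d) (copies (max b c) col01) \<and>
            int (forb m r (copies (max b c) col01)) =
              2 * (int r - 1) ^ m - (int r - 2) ^ m + (int (max b c) - 1) * int m * (int m - 1))"
proof (intro conjI impI)
  have r: "r \<ge> 2" using assms(1) by simp
  \<comment> \<open>The formulas of the theorem subtract in the integers, those of the lemmas in the
    naturals.\<close>
  have int_r: "int r - 1 = int (r - 1)" "int r - 2 = int (r - 2)" using assms(1) by auto
  have \<alpha>: "\<alpha> = max a (max d (min b c))" using assms(4) by simp
  have large: "(r - 2) ^ (m - 2) \<ge> 2 * max a (max b (max c d))" using assms(5) by simp
  {
    assume "\<alpha> > 0"
    have "max \<alpha> (max b c) \<le> max a (max b (max c d))" unfolding \<alpha> by auto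
    with large have "(r - 2) ^ (m - 2) \<ge> 2 * max \<alpha> (max b c)" by linarith
    from forb_F_abcd[OF r \<alpha> \<open>\<alpha> > 0\<close> this]
    show "int (forb m r (F_abcd a b c d)) =
        int m * (int r - 1) ^ (m - 1) + (int r - 1) ^ m + (int \<alpha> - 1) * int (m choose 2)"
      using \<open>\<alpha> > 0\<close> by (simp add: int_r of_nat_diff Suc_leI)
  }
  assume "\<not> \<alpha> > 0"
  then show "a = 0" and "d = 0" and bc: "min b c = 0" unfolding \<alpha> by simp_all
  then show "row_col_perm (F_abcd a b c d) (copies (max b c) col01)"
    using row_col_perm_F_abcd_copies by simp
  \<comment> \<open>This is where it matters that \<open>a\<close>, \<open>b\<close>,
    \<open>c\<close>, \<open>d\<close> are not all zero.\<close>
  have p: "max b c > 0" using assms(3) \<open>a = 0\<close> \<open>d = 0\<close> by auto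
  have "(r - 2) ^ (m - 2) \<ge> 2 * max b c" using large by linarith
  moreover have "(r - 2) ^ m \<le> 2 * (r - 1) ^ m"
    using power_mono[of "r - 2" "r - 1" m] by linarith
  ultimately show "int (forb m r (copies (max b c) col01)) =
      2 * (int r - 1) ^ m - (int r - 2) ^ m + (int (max b c) - 1) * int m * (int m - 1)"
    using forb_copies_col01[OF r p] p assms(2) by (simp add: int_r of_nat_diff Suc_leI del: of_nat_max)
qed

end
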